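(* Let $H$ be a $\{1,2\}$-graph such that its level graph $H^2$ is not bipartite. Then $$\pi(H)=2-\frac{1}{\chi(H^2)-1},$$ where $\chi(H^2)$ is the chromatic number of the graph $H^2$.
   Context: A hypergraph $H=(V,E)$ has edges that are subsets of $V$; its set of edge types is $R(H)=\{|F|:F\in E\}$, and $H$ is called an $R(H)$-graph; a $\{1,2\}$-graph has edges of sizes 1 and 2. For $j\in R(H)$, $H^j$ is the hypergraph of all edges of $H$ with $j$ vertices. The complete hypergraph $K^R_n$ on $[n]$ has edge set $\bigcup_{i\in R}\binom{[n]}{i}$. For a hypergraph $G$ on $n$ vertices, its Lubell function is $h_n(G)=\sum_{k\in R(G)}|E(G^k)|/\binom{n}{k}$. For a hypergraph $F$ with $R=R(F)$, the Turán density is $$\pi(F)=\lim_{n\to\infty}\max\{h_n(G): |V(G)|=n,\ G\subseteq K^R_n,\ G\text{ contains no subgraph isomorphic to }F\}$$ (this limit exists). *)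

theory Defs
  imports Complex_Main
begin

text \<open>A hypergraph is a pair of a vertex set and a set of edges.\<close>

type_synonym 'a hypergraph = "'a set \<times> 'a set set"

abbreviation verts :: "'a hypergraph \<Rightarrow> 'a set" where
  "verts H \<equiv> fst H"

abbreviation edges :: "'a hypergraph \<Rightarrow> 'a set set" where
  "edges H \<equiv> snd H"

definition hypergraph :: "'a hypergraph \<Rightarrow> bool" where
  "hypergraph H \<longleftrightarrow> (\<forall>e\<in>edges H. e \<subseteq> verts H)"

definition edge_types :: "'a hypergraph \<Rightarrow> nat set" where
  "edge_types H = card ` edges H"

definition level :: "'a hypergraph \<Rightarrow> nat \<Rightarrow> 'a hypergraph" where
  "level H j = (verts H, {e \<in> edges H. card e = j})"

definition subhypergraph :: "'a hypergraph \<Rightarrow> 'a hypergraph \<Rightarrow> bool" where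
  "subhypergraph G' G \<longleftrightarrow> hypergraph G' \<and> verts G' \<subseteq> verts G \<and> edges G' \<subseteq> edges G"

definition isomorphic :: "'a hypergraph \<Rightarrow> 'b hypergraph \<Rightarrow> bool" where
  "isomorphic G H \<longleftrightarrow> (\<exists>f. bij_betw f (verts G) (verts H) \<and> (\<lambda>e. f ` e) ` edges G = edges H)"

definition complete_hypergraph :: "nat set \<Rightarrow> nat \<Rightarrow> nat hypergraph" where
  "complete_hypergraph R n = ({1..n}, \<Union>i\<in>R. {e. e \<subseteq> {1..n} \<and> card e = i})"

definition lubell :: "'a hypergraph \<Rightarrow> real" where
  "lubell G = (\<Sum>k\<in>edge_types G.
     real (card (edges (level G k))) / real (card (verts G) choose k))"

text \<open>
  The requirement that \<open>G\<close> has \<open>n\<close> vertices and is contained in the complete hypergraph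
  on \<open>{1..n}\<close> forces \<open>verts G = {1..n}\<close>. The maximum is thus over a finite set, which is
  nonempty as soon as \<open>F\<close> has an edge.
\<close>

definition max_lubell :: "'a hypergraph \<Rightarrow> nat \<Rightarrow> real" where
  "max_lubell F n = Max {lubell G | G.
     card (verts G) = n \<and> subhypergraph G (complete_hypergraph (edge_types F) n) \<and>
     \<not> (\<exists>F'. subhypergraph F' G \<and> isomorphic F' F)}"

definition turan_density :: "'a hypergraph \<Rightarrow> real" where
  "turan_density F = lim (max_lubell F)"

text \<open>The following two notions are meant for graphs, i.e. when all edges have two vertices.\<close>

definition bipartite :: "'a hypergraph \<Rightarrow> bool" where
  "bipartite G \<longleftrightarrow> (\<exists>A B. A \<union> B = verts G \<and> A \<inter> B = {} \<and>
     (\<forall>e\<in>edges G. \<exists>a\<in>A. \<exists>b\<in>B. e = {a, b}))"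

definition proper_coloring :: "'a hypergraph \<Rightarrow> nat \<Rightarrow> ('a \<Rightarrow> nat) \<Rightarrow> bool" where
  "proper_coloring G k c \<longleftrightarrow> c ` verts G \<subseteq> {..<k} \<and>
     (\<forall>u v. u \<noteq> v \<longrightarrow> {u, v} \<in> edges G \<longrightarrow> c u \<noteq> c v)"

definition chromatic_number :: "'a hypergraph \<Rightarrow> nat" where
  "chromatic_number G = (LEAST k. \<exists>c. proper_coloring G k c)"

end

theory Submission
  imports Defs "HOL-Library.FuncSet" "HOL-Real_Asymp.Real_Asymp"
begin

text \<open>
  Put \<open>r = \<chi>(H\<^sup>2) - 1\<close>. All singletons together with a Turan graph with \<open>r\<close> parts give the lower
  bound. Conversely, if \<open>G\<close> is \<open>H\<close>-free and \<open>S\<close> is the set of its singletons, \<open>|S| = x n\<close>, then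
  the pairs of \<open>G\<close> inside \<open>S\<close> form an \<open>H\<^sup>2\<close>-free graph, so by the Erdos-Stone theorem the Lubell
  function is at most \<open>x + 1 - x\<^sup>2 / r + o(1)\<close>. As \<open>r \<ge> 2\<close>, which is where non-bipartiteness enters,
  this is largest at \<open>x = 1\<close>. The Erdos-Stone theorem is proved by induction on the number of
  parts: under a minimum degree condition, linearly many vertices have many neighbours in every part
  of a large blow-up, and by pigeonhole some of them share enough of these neighbours to form a
  further part.
\<close>

section \<open>Counting ordered adjacent pairs\<close>

text \<open>Ordered pairs make every edge count twice, so densities are compared with
  \<open>(card V)\<^sup>2\<close> directly and no binomial coefficients enter the Erdos-Stone
  argument.\<close>

definition arcs :: "('a \<Rightarrow> 'a \<Rightarrow> bool) \<Rightarrow> 'a set \<Rightarrow> ('a \<times> 'a) set" where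
  "arcs adj S = {(u, v). u \<in> S \<and> v \<in> S \<and> adj u v}"

text \<open>A complete \<open>k\<close>-partite graph with parts of size \<open>t\<close>, as a
  subgraph that need not be induced: pairs inside a part are unrestricted. For irreflexive
  \<open>adj\<close> and distinct indices the parts are automatically disjoint.\<close>

definition has_blowup :: "('a \<Rightarrow> 'a \<Rightarrow> bool) \<Rightarrow> 'a set \<Rightarrow> nat \<Rightarrow> nat \<Rightarrow> bool" where
  "has_blowup adj V k t \<longleftrightarrow> (\<exists>B. (\<forall>i<k. B i \<subseteq> V \<and> card (B i) = t) \<and>
     (\<forall>i<k. \<forall>j<k. i \<noteq> j \<longrightarrow> (\<forall>u\<in>B i. \<forall>v\<in>B j. adj u v)))"

lemma finite_arcs: "finite S \<Longrightarrow> finite (arcs adj S)"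
  by (rule finite_subset[of _ "S \<times> S"]) (auto simp: arcs_def)

lemma card_arcs_le: "finite S \<Longrightarrow> card (arcs adj S) \<le> card S * card S"
  using card_mono[of "S \<times> S" "arcs adj S"] by (auto simp: arcs_def card_cartesian_product)

text \<open>The arcs through \<open>v\<close> are \<open>{v} \<times> N\<close> and
  \<open>N \<times> {v}\<close>, disjoint because \<open>v\<close> is not its own neighbour. This
  measures the effect of a vertex deletion on the potential used below.\<close>

lemma card_arcs_remove:
  assumes "finite S" "v \<in> S" "symp adj" "irreflp adj"
  shows "card (arcs adj S) = card (arcs adj (S - {v})) + 2 * card {u \<in> S. adj v u}"
proof -
  define N where "N = {u \<in> S. adj v u}"
  have fin: "finite N" using assms by (simp add: N_def)
  have irr: "\<not> adj v v" using assms(4) by (simp add: irreflp_def)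
  have "arcs adj S = arcs adj (S - {v}) \<union> ({v} \<times> N \<union> N \<times> {v})"
    using assms(2,3) by (auto simp: arcs_def N_def dest: sympD)
  also have "card \<dots> = card (arcs adj (S - {v})) + card ({v} \<times> N \<union> N \<times> {v})"
    by (rule card_Un_disjoint) (use fin assms(1) in \<open>simp_all add: finite_arcs, auto simp: arcs_def\<close>)
  also have "card ({v} \<times> N \<union> N \<times> {v}) = card ({v} \<times> N) + card (N \<times> {v})"
    by (rule card_Un_disjoint) (use fin irr in \<open>auto simp: N_def\<close>)
  finally show ?thesis by (simp add: N_def card_cartesian_product)
qed

lemma sum_card_swap:
  assumes "finite A" "finite B"
  shows "(\<Sum>a\<in>A. card {b \<in> B. P a b}) = (\<Sum>b\<in>B. card {a \<in> A. P a b})"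
proof -
  have "(\<Sum>a\<in>A. card {b \<in> B. P a b}) = (\<Sum>a\<in>A. \<Sum>b\<in>B. if P a b then 1 else 0)"
    using assms by (simp add: sum.If_cases Int_def)
  also have "\<dots> = (\<Sum>b\<in>B. \<Sum>a\<in>A. if P a b then 1 else 0)"
    by (rule sum.swap)
  also have "\<dots> = (\<Sum>b\<in>B. card {a \<in> A. P a b})"
    using assms by (simp add: sum.If_cases Int_def)
  finally show ?thesis .
qed

section \<open>The Erdos-Stone theorem\<close>

text \<open>Double counting of non-adjacent pairs between \<open>V - W\<close> and the parts. A
  vertex outside \<open>W\<close> has fewer than \<open>t\<close> neighbours in some part and so
  misses at least \<open>T - t\<close> vertices there; each of the \<open>r * T\<close> vertices in
  the parts is missed by at most \<open>(1 - \<delta>) * card V / r\<close> vertices.\<close>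

lemma many_common_neighbours:
  fixes B :: "nat \<Rightarrow> 'a set" and \<delta> :: real
  assumes fin: "finite V" and sym: "symp adj" and "r > 0"
    and B: "\<And>i. i < r \<Longrightarrow> B i \<subseteq> V \<and> card (B i) = T"
    and miss: "\<And>v. v \<in> V \<Longrightarrow> real r * card {u \<in> V. \<not> adj v u} \<le> (1 - \<delta>) * card V"
    and \<delta>: "0 < \<delta>" "\<delta> < 1" and T: "T > 0" "real t \<le> \<delta> / 2 * T"
  shows "\<delta> / 2 * card V \<le> card {v \<in> V. \<forall>i<r. t \<le> card {u \<in> B i. adj v u}}"
proof -
  define W where "W = {v \<in> V. \<forall>i<r. t \<le> card {u \<in> B i. adj v u}}"
  have W: "W \<subseteq> V" "finite W" using fin by (auto simp: W_def)
  have finB: "finite (B i)" if "i < r" for i using B[OF that] fin by (auto intro: finite_subset)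
  have low: "T - t \<le> (\<Sum>i<r. card {u \<in> B i. \<not> adj v u})" if v: "v \<in> V - W" for v
  proof -
    from v obtain i where i: "i < r" "card {u \<in> B i. adj v u} < t"
      by (auto simp: W_def not_le)
    have "T = card ({u \<in> B i. adj v u} \<union> {u \<in> B i. \<not> adj v u})"
      using B[OF i(1)] by (auto intro!: arg_cong[where f = card])
    also have "\<dots> \<le> card {u \<in> B i. adj v u} + card {u \<in> B i. \<not> adj v u}"
      by (rule card_Un_le)
    finally have "T - t \<le> card {u \<in> B i. \<not> adj v u}" using i by linarith
    also have "\<dots> \<le> (\<Sum>i<r. card {u \<in> B i. \<not> adj v u})"
      by (rule member_le_sum) (use i in auto)
    finally show ?thesis .
  qed
  have "card (V - W) * (T - t) \<le> (\<Sum>v\<in>V - W. \<Sum>i<r. card {u \<in> B i. \<not> adj v u})"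
    using sum_mono[of "V - W" "\<lambda>_. T - t"] low by simp
  also have "\<dots> \<le> (\<Sum>v\<in>V. \<Sum>i<r. card {u \<in> B i. \<not> adj v u})"
    by (rule sum_mono2) (use fin in auto)
  also have "\<dots> = (\<Sum>i<r. \<Sum>v\<in>V. card {u \<in> B i. \<not> adj v u})"
    by (rule sum.swap)
  also have "\<dots> = (\<Sum>i<r. \<Sum>u\<in>B i. card {v \<in> V. \<not> adj v u})"
    by (intro sum.cong refl sum_card_swap) (use fin finB in auto)
  finally have "real (card (V - W) * (T - t)) \<le> real (\<Sum>i<r. \<Sum>u\<in>B i. card {v \<in> V. \<not> adj v u})"
    by (simp only: of_nat_le_iff)
  also have "\<dots> = (\<Sum>i<r. \<Sum>u\<in>B i. real (card {v \<in> V. \<not> adj v u}))"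
    by simp
  also have "\<dots> \<le> (\<Sum>i<r. \<Sum>u\<in>B i. (1 - \<delta>) * card V / r)"
  proof (intro sum_mono)
    fix i u assume "i \<in> {..<r}" "u \<in> B i"
    then have "u \<in> V" using B by auto
    \<comment> \<open>The swap of sums counts the vertices that miss \<open>u\<close>; by symmetry
      these are the non-neighbours of \<open>u\<close>, which \<open>miss\<close> bounds.\<close>
    moreover have "{v \<in> V. \<not> adj v u} = {v \<in> V. \<not> adj u v}"
      using sym by (auto dest: sympD)
    ultimately show "real (card {v \<in> V. \<not> adj v u}) \<le> (1 - \<delta>) * card V / r"
      using miss[of u] \<open>r > 0\<close> by (simp add: field_simps)
  qed
  also have "\<dots> = (1 - \<delta>) * card V * T"
    using B \<open>r > 0\<close> by simp
  finally have *: "real (card (V - W)) * real (T - t) \<le> (1 - \<delta>) * card V * T"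
    by simp
  \<comment> \<open>Ensures that the natural subtraction \<open>T - t\<close> is not
    truncated.\<close>
  have tT: "t \<le> T"
  proof -
    have "\<delta> / 2 * T \<le> 1 * real T" using \<delta> by (intro mult_right_mono) auto
    then show ?thesis using T by linarith
  qed
  have "(1 - \<delta> / 2) * T \<le> real (T - t)"
    using T tT by (simp add: of_nat_diff algebra_simps)
  then have "real (card (V - W)) * ((1 - \<delta> / 2) * T) \<le> (1 - \<delta>) * card V * T"
    using * by (meson mult_left_mono of_nat_0_le_iff order_trans)
  then have "real (card (V - W)) * (1 - \<delta> / 2) * T \<le> (1 - \<delta>) * card V * T"
    by (simp only: mult.assoc)
  then have 1: "real (card (V - W)) * (1 - \<delta> / 2) \<le> (1 - \<delta>) * card V"
    using T by (simp only: mult_le_cancel_right_pos of_nat_0_less_iff)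
  \<comment> \<open>The square of \<open>1 - \<delta> / 2\<close> exceeds
    \<open>1 - \<delta>\<close> by \<open>(\<delta> / 2)\<^sup>2\<close>; one of the two factors is
    then cancelled.\<close>
  have "(1 - \<delta>) * card V \<le> ((1 - \<delta> / 2) * card V) * (1 - \<delta> / 2)"
  proof -
    have "1 - \<delta> \<le> (1 - \<delta> / 2) * (1 - \<delta> / 2)"
      by (simp add: algebra_simps)
    then show ?thesis
      by (metis (no_types, opaque_lifting) mult.commute mult.left_commute mult_left_mono of_nat_0_le_iff)
  qed
  with 1 have "real (card (V - W)) * (1 - \<delta> / 2) \<le> ((1 - \<delta> / 2) * card V) * (1 - \<delta> / 2)"
    by linarith
  then have "real (card (V - W)) \<le> (1 - \<delta> / 2) * card V"
    by (rule mult_right_le_imp_le) (use \<delta> in auto)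
  moreover have "card (V - W) = card V - card W" "card W \<le> card V"
    using W fin by (auto intro: card_Diff_subset card_mono)
  ultimately have "\<delta> / 2 * card V \<le> card W"
    by (simp add: of_nat_diff algebra_simps)
  then show ?thesis by (simp add: W_def)
qed

text \<open>Each vertex of \<open>W\<close> leaves a trace on \<open>U\<close>, its neighbourhood
  there, and there are at most \<open>2 ^ (r * T)\<close> traces. Hence \<open>t\<close> vertices
  share one trace \<open>X\<close>. They form the new part, and each old part shrinks to
  \<open>t\<close> of its vertices in \<open>X\<close>.\<close>

lemma blowup_extend:
  fixes B :: "nat \<Rightarrow> 'a set"
  assumes fin: "finite V" and sym: "symp adj"
    and B: "\<And>i. i < r \<Longrightarrow> B i \<subseteq> V \<and> card (B i) = T"
    and adj: "\<And>i j u v. i < r \<Longrightarrow> j < r \<Longrightarrow> i \<noteq> j \<Longrightarrow> u \<in> B i \<Longrightarrow> v \<in> B j \<Longrightarrow> adj u v"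
    and large: "2 ^ (r * T) * t \<le> card {v \<in> V. \<forall>i<r. t \<le> card {u \<in> B i. adj v u}}"
  shows "has_blowup adj V (Suc r) t"
proof -
  define W where "W = {v \<in> V. \<forall>i<r. t \<le> card {u \<in> B i. adj v u}}"
  define U where "U = (\<Union>i<r. B i)"
  define f where "f v = {u \<in> U. adj v u}" for v
  have W: "W \<subseteq> V" "finite W" using fin by (auto simp: W_def)
  have finB: "finite (B i)" if "i < r" for i using B[OF that] fin by (auto intro: finite_subset)
  have finU: "finite U" using finB by (simp add: U_def)
  have "card U \<le> (\<Sum>i<r. card (B i))" unfolding U_def by (rule card_UN_le) simp
  also have "\<dots> = r * T" using B by simp
  finally have cU: "card (Pow U) \<le> 2 ^ (r * T)" using finU by (simp add: card_Pow)
  have "\<exists>X\<in>Pow U. card W \<le> card (f -` {X} \<inter> W) * card (Pow U)"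
    by (rule pigeonhole_card) (use W finU in \<open>auto simp: f_def\<close>)
  then obtain X where X: "X \<subseteq> U" "card W \<le> card (f -` {X} \<inter> W) * card (Pow U)" by blast
  have "t * card (Pow U) \<le> t * 2 ^ (r * T)" using cU by simp
  also have "\<dots> \<le> card W" using large by (simp add: W_def mult.commute)
  also note X(2)
  finally have "t \<le> card (f -` {X} \<inter> W)"
    using finU by (simp add: card_Pow)
  also have "f -` {X} \<inter> W = {w \<in> W. f w = X}" by auto
  finally have "t \<le> card {w \<in> W. f w = X}" .
  from obtain_subset_with_card_n[OF this]
  obtain Y where Y: "Y \<subseteq> {w \<in> W. f w = X}" "card Y = t" .
  have "\<exists>C. C \<subseteq> B i \<and> card C = t \<and> (\<forall>y\<in>Y. \<forall>u\<in>C. adj y u)" if i: "i < r" for i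
  \<comment> \<open>\<open>Y\<close> is empty just when \<open>t = 0\<close>; then no
    \<open>y\<close> is available to show that the trace is large in \<open>B i\<close>, but the
    empty set serves as \<open>C\<close>.\<close>
  proof (cases "Y = {}")
    case True
    then show ?thesis using Y by (intro exI[of _ "{}"]) auto
  next
    case False
    then obtain y where y: "y \<in> Y" by blast
    then have "t \<le> card {u \<in> B i. adj y u}" using Y i by (auto simp: W_def)
    from obtain_subset_with_card_n[OF this]
    obtain C where C: "C \<subseteq> {u \<in> B i. adj y u}" "card C = t" .
    have "C \<subseteq> X" using y Y C i by (auto simp: f_def U_def)
    then have "\<forall>y'\<in>Y. \<forall>u\<in>C. adj y' u" using Y by (auto simp: f_def)
    then show ?thesis using C by blast
  qed
  then obtain C where C: "\<And>i. i < r \<Longrightarrow> C i \<subseteq> B i \<and> card (C i) = t \<and> (\<forall>y\<in>Y. \<forall>u\<in>C i. adj y u)"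
    by metis
  define D where "D i = (if i < r then C i else Y)" for i
  have "D i \<subseteq> V \<and> card (D i) = t" if "i < Suc r" for i
    using that C[of i] B[of i] Y W by (auto simp: D_def)
  moreover have "adj u v" if "i < Suc r" "j < Suc r" "i \<noteq> j" "u \<in> D i" "v \<in> D j" for i j u v
    using that C[of i] C[of j] adj[of i j u v] sympD[OF sym, of v u]
    by (auto simp: D_def less_Suc_eq split: if_splits)
  ultimately show ?thesis unfolding has_blowup_def by blast
qed

text \<open>The degree condition is stated through non-neighbours and without division, so that the
  case \<open>r = 0\<close> starts the induction.\<close>

lemma min_degree_blowup:
  fixes \<delta> :: real
  assumes \<delta>: "0 < \<delta>" "\<delta> < 1"
  shows "\<exists>n0. \<forall>(V :: 'a set) adj. finite V \<longrightarrow> symp adj \<longrightarrow> n0 \<le> card V \<longrightarrow>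
    (\<forall>v\<in>V. real r * card {u \<in> V. \<not> adj v u} \<le> (1 - \<delta>) * card V) \<longrightarrow>
    has_blowup adj V (Suc r) t"
proof (induction r arbitrary: t)
  case 0
  have "has_blowup adj V (Suc 0) t" if t: "t \<le> card V" for V :: "'a set" and adj
  proof -
    obtain S where "S \<subseteq> V" "card S = t"
      using obtain_subset_with_card_n[OF t] by blast
    then show ?thesis unfolding has_blowup_def by (intro exI[of _ "\<lambda>_. S"]) simp
  qed
  then show ?case by blast
next
  case (Suc r)
  \<comment> \<open>The induction hypothesis is used with parts of the larger size \<open>T\<close>,
    chosen so that \<open>t\<close> is at most the fraction \<open>\<delta> / 2\<close> of it;
    \<open>Suc\<close> keeps \<open>T\<close> positive when \<open>t = 0\<close>.\<close>
  define T where "T = Suc (nat \<lceil>2 * t / \<delta>\<rceil>)"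
  have "2 * t / \<delta> \<le> T" unfolding T_def by linarith
  then have T: "T > 0" "real t \<le> \<delta> / 2 * T"
    using \<delta> by (auto simp: T_def field_simps)
  obtain n1 where n1: "\<forall>(V :: 'a set) adj. finite V \<longrightarrow> symp adj \<longrightarrow> n1 \<le> card V \<longrightarrow>
    (\<forall>v\<in>V. real r * card {u \<in> V. \<not> adj v u} \<le> (1 - \<delta>) * card V) \<longrightarrow>
    has_blowup adj V (Suc r) T"
    using Suc[of T] by (rule exE)
  \<comment> \<open>From this size on, the \<open>\<delta> / 2 * card V\<close> good vertices
    suffice for the pigeonhole argument on traces.\<close>
  define n2 where "n2 = nat \<lceil>2 * (2 ^ (Suc r * T) * t) / \<delta>\<rceil>"
  have "has_blowup adj V (Suc (Suc r)) t"
    if V: "finite V" "symp adj" "max n1 n2 \<le> card V"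
      and miss: "\<forall>v\<in>V. real (Suc r) * card {u \<in> V. \<not> adj v u} \<le> (1 - \<delta>) * card V"
    for V :: "'a set" and adj
  proof -
    \<comment> \<open>The degree condition for \<open>Suc r\<close> implies that for
      \<open>r\<close> with the same \<open>\<delta>\<close>.\<close>
    have "has_blowup adj V (Suc r) T"
    proof (rule n1[rule_format])
      fix v assume v: "v \<in> V"
      have "real r * card {u \<in> V. \<not> adj v u} \<le> real (Suc r) * card {u \<in> V. \<not> adj v u}"
        by (intro mult_right_mono) auto
      with miss v show "real r * card {u \<in> V. \<not> adj v u} \<le> (1 - \<delta>) * card V"
        by fastforce
    qed (use V in auto)
    then obtain B where B: "\<And>i. i < Suc r \<Longrightarrow> B i \<subseteq> V \<and> card (B i) = T"
      and adj: "\<And>i j u v. i < Suc r \<Longrightarrow> j < Suc r \<Longrightarrow> i \<noteq> j \<Longrightarrow> u \<in> B i \<Longrightarrow> v \<in> B j \<Longrightarrow> adj u v"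
      unfolding has_blowup_def by metis
    have "\<delta> / 2 * card V \<le> card {v \<in> V. \<forall>i<Suc r. t \<le> card {u \<in> B i. adj v u}}"
      by (rule many_common_neighbours[where T = T]) (use V B miss \<delta> T in auto)
    moreover have "2 * (2 ^ (Suc r * T) * t) / \<delta> \<le> card V"
      using V(3) unfolding n2_def by linarith
    then have "real (2 ^ (Suc r * T) * t) \<le> \<delta> / 2 * card V"
      using \<delta> by (simp add: field_simps)
    ultimately have "real (2 ^ (Suc r * T) * t)
        \<le> real (card {v \<in> V. \<forall>i<Suc r. t \<le> card {u \<in> B i. adj v u}})"
      by linarith
    then have "2 ^ (Suc r * T) * t \<le> card {v \<in> V. \<forall>i<Suc r. t \<le> card {u \<in> B i. adj v u}}"
      by (simp only: of_nat_le_iff)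
    from blowup_extend[OF V(1,2) B adj this] show ?thesis .
  qed
  then show ?case by blast
qed

text \<open>Every vertex deletion that violates the degree bound \<open>c |S|\<close> increases the potential
  \<open>2 e(S) - c |S| (|S| + 1)\<close>, so a maximiser satisfies the bound.\<close>

lemma dense_subset_min_degree:
  fixes c :: real
  assumes fin: "finite V" and "symp adj" "irreflp adj" and c: "c \<ge> 0"
  shows "\<exists>S\<subseteq>V. (\<forall>v\<in>S. c * card S \<le> card {u \<in> S. adj v u}) \<and>
    card (arcs adj V) - c * card V * (card V + 1) \<le> (card S)\<^sup>2"
proof -
  define f where "f S = card (arcs adj S) - c * card S * (card S + 1)" for S
  have "finite (f ` Pow V)" "f ` Pow V \<noteq> {}" using fin by auto
  then have "Max (f ` Pow V) \<in> f ` Pow V" by (rule Max_in)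
  then obtain S where S: "S \<subseteq> V" and "Max (f ` Pow V) = f S" by auto
  then have max: "f S' \<le> f S" if "S' \<subseteq> V" for S'
    using that fin by (metis Max_ge PowI \<open>finite (f ` Pow V)\<close> imageI)
  have finS: "finite S" using S fin by (rule finite_subset)
  have "c * card S \<le> card {u \<in> S. adj v u}" if v: "v \<in> S" for v
  proof -
    have cS: "real (card (S - {v})) = real (card S) - 1"
      using card.remove[OF finS v] by simp
    \<comment> \<open>Deleting \<open>v\<close> costs twice its degree in arcs and lowers the
      subtracted term by \<open>2 * (c * card S)\<close>.\<close>
    have "f (S - {v}) \<le> f S" using max S by blast
    then have "c * card S * (card S + 1) - c * (real (card S) - 1) * card S
        \<le> 2 * card {u \<in> S. adj v u}"
      using card_arcs_remove[OF finS v assms(2,3)] by (simp add: f_def cS)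
    moreover have "c * card S * (card S + 1) - c * (real (card S) - 1) * card S = 2 * (c * card S)"
      by (simp add: algebra_simps)
    ultimately show ?thesis by linarith
  qed
  \<comment> \<open>This forces the maximiser to be large when \<open>V\<close> is dense: the
    potential of \<open>S\<close> cannot exceed its number of arcs.\<close>
  moreover have "f V \<le> (card S)\<^sup>2"
  proof -
    have "f V \<le> f S" using max by blast
    also have "f S \<le> card (arcs adj S)" using c by (simp add: f_def)
    also have "\<dots> \<le> (card S)\<^sup>2"
      using card_arcs_le[OF finS, of adj] by (simp add: power2_eq_square flip: of_nat_mult)
    finally show ?thesis .
  qed
  ultimately show ?thesis using S by (auto simp: f_def)
qed

lemma has_blowup_mono:
  assumes "has_blowup adj S k t" "S \<subseteq> V"
  shows "has_blowup adj V k t"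
proof -
  obtain B where "\<forall>i<k. B i \<subseteq> S \<and> card (B i) = t"
    and "\<forall>i<k. \<forall>j<k. i \<noteq> j \<longrightarrow> (\<forall>u\<in>B i. \<forall>v\<in>B j. adj u v)"
    using assms(1) unfolding has_blowup_def by blast
  then show ?thesis using assms(2) unfolding has_blowup_def by (intro exI[of _ B]) (simp, blast)
qed

text \<open>Reduces to the minimum degree version: a dense graph has a large subset \<open>S\<close>
  in which all degrees are at least \<open>c * card S\<close>, with \<open>c\<close> half way
  between \<open>1 - 1 / r\<close> and the given density.\<close>

theorem erdos_stone:
  fixes \<epsilon> :: real
  assumes r: "r > 0" and \<epsilon>: "\<epsilon> > 0"
  shows "\<exists>n0. \<forall>(V :: 'a set) adj. finite V \<longrightarrow> symp adj \<longrightarrow> irreflp adj \<longrightarrow> n0 \<le> card V \<longrightarrow>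
    (1 - 1 / r + \<epsilon>) * (card V)\<^sup>2 \<le> card (arcs adj V) \<longrightarrow> has_blowup adj V (Suc r) t"
proof -
  \<comment> \<open>Degrees of at least \<open>c * card S\<close> leave \<open>r\<close> times the
    non-neighbours at most \<open>(1 - r * \<epsilon> / 2) * card S\<close>; the cap
    \<open>1 / 2\<close> only secures \<open>\<delta> < 1\<close>.\<close>
  define \<delta> where "\<delta> = min (r * \<epsilon> / 2) (1 / 2)"
  have \<delta>: "0 < \<delta>" "\<delta> < 1" "\<delta> \<le> r * \<epsilon> / 2" using r \<epsilon> by (auto simp: \<delta>_def)
  obtain n1 where n1: "\<forall>(V :: 'a set) adj. finite V \<longrightarrow> symp adj \<longrightarrow> n1 \<le> card V \<longrightarrow>
    (\<forall>v\<in>V. real r * card {u \<in> V. \<not> adj v u} \<le> (1 - \<delta>) * card V) \<longrightarrow>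
    has_blowup adj V (Suc r) t"
    using min_degree_blowup[OF \<delta>(1,2), of r t] by (rule exE)
  define c where "c = 1 - 1 / r + \<epsilon> / 2"
  have c: "c \<ge> 0" using r \<epsilon> by (simp add: c_def)
  \<comment> \<open>The right-hand expression is what remains of the potential of \<open>V\<close>
    at the assumed density; once it exceeds \<open>n1\<^sup>2\<close>, so does
    \<open>(card S)\<^sup>2\<close>.\<close>
  have "filterlim (\<lambda>n. \<epsilon> / 2 * real n ^ 2 - c * real n) at_top sequentially"
    using \<epsilon> by real_asymp
  then have "eventually (\<lambda>n. real (n1\<^sup>2) \<le> \<epsilon> / 2 * real n ^ 2 - c * real n) sequentially"
    by (simp add: filterlim_at_top)
  then obtain n0 where n0: "\<And>n. n \<ge> n0 \<Longrightarrow> real (n1\<^sup>2) \<le> \<epsilon> / 2 * real n ^ 2 - c * real n"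
    by (auto simp: eventually_sequentially)
  have "has_blowup adj V (Suc r) t"
    if V: "finite V" "symp adj" "irreflp adj" "n0 \<le> card V"
      and dense: "(1 - 1 / r + \<epsilon>) * (card V)\<^sup>2 \<le> card (arcs adj V)"
    for V :: "'a set" and adj
  proof -
    obtain S where S: "S \<subseteq> V" "\<forall>v\<in>S. c * card S \<le> card {u \<in> S. adj v u}"
      "card (arcs adj V) - c * card V * (card V + 1) \<le> (card S)\<^sup>2"
      using dense_subset_min_degree[OF V(1-3) c] by blast
    have finS: "finite S" using S(1) V(1) by (rule finite_subset)
    have "real (n1\<^sup>2) \<le> \<epsilon> / 2 * real (card V) ^ 2 - c * card V" using n0 V(4) by blast
    also have "\<dots> = (c + \<epsilon> / 2) * (card V)\<^sup>2 - c * card V * (card V + 1)"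
      by (simp add: algebra_simps power2_eq_square)
    also have "\<dots> \<le> (card S)\<^sup>2"
    proof -
      have "c + \<epsilon> / 2 = 1 - 1 / r + \<epsilon>" by (simp add: c_def)
      then show ?thesis using S(3) dense by (simp only:)
    qed
    finally have "n1\<^sup>2 \<le> (card S)\<^sup>2" by (simp only: of_nat_le_iff)
    then have "n1 \<le> card S" by (simp add: power2_nat_le_eq_le)
    moreover have "real r * card {u \<in> S. \<not> adj v u} \<le> (1 - \<delta>) * card S" if v: "v \<in> S" for v
    proof -
      have "card S = card ({u \<in> S. adj v u} \<union> {u \<in> S. \<not> adj v u})"
        by (rule arg_cong[where f = card]) auto
      also have "\<dots> = card {u \<in> S. adj v u} + card {u \<in> S. \<not> adj v u}"
        by (rule card_Un_disjoint) (use finS in auto)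
      finally have "real (card S) = real (card {u \<in> S. adj v u}) + real (card {u \<in> S. \<not> adj v u})"
        by (simp flip: of_nat_add)
      with bspec[OF S(2) v] have "real (card {u \<in> S. \<not> adj v u}) \<le> (1 - c) * card S"
        by (simp add: algebra_simps)
      then have "real r * card {u \<in> S. \<not> adj v u} \<le> real r * ((1 - c) * card S)"
        by (rule mult_left_mono) simp
      also have "\<dots> = (1 - r * \<epsilon> / 2) * card S"
        using r by (simp add: c_def field_simps)
      also have "\<dots> \<le> (1 - \<delta>) * card S"
        using \<delta> by (intro mult_right_mono) auto
      finally show ?thesis .
    qed
    ultimately have "has_blowup adj S (Suc r) t"
      by (intro n1[rule_format]) (use finS V(2) in auto)
    then show ?thesis using S(1) by (rule has_blowup_mono)
  qed
  then show ?thesis by blast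
qed


section \<open>The Lubell function in terms of arcs\<close>

lemma card_arcs_edges:
  assumes "finite S"
  shows "card (arcs (\<lambda>u v. u \<noteq> v \<and> {u, v} \<in> E) S) = 2 * card {e \<in> E. e \<subseteq> S \<and> card e = 2}"
proof -
  let ?E = "{e \<in> E. e \<subseteq> S \<and> card e = 2}"
  have fin: "finite ?E" using assms by (auto intro: finite_subset[of _ "Pow S"])
  have pairs: "card {(u, v). u \<noteq> v \<and> {u, v} = e} = 2 \<and> finite {(u, v). u \<noteq> v \<and> {u, v} = e}"
    if e: "card e = 2" for e :: "'a set"
  proof -
    obtain a b where ab: "e = {a, b}" "a \<noteq> b" using e by (auto simp: card_2_iff)
    then have "{(u, v). u \<noteq> v \<and> {u, v} = e} = {(a, b), (b, a)}"
      by (auto simp: doubleton_eq_iff)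
    then show ?thesis using ab by simp
  qed
  have "arcs (\<lambda>u v. u \<noteq> v \<and> {u, v} \<in> E) S = (\<Union>e\<in>?E. {(u, v). u \<noteq> v \<and> {u, v} = e})"
    by (auto simp: arcs_def)
  also have "card \<dots> = (\<Sum>e\<in>?E. card {(u, v). u \<noteq> v \<and> {u, v} = e})"
    by (rule card_UN_disjoint) (use fin pairs in auto)
  also have "\<dots> = (\<Sum>e\<in>?E. 2)"
    by (rule sum.cong) (use pairs in auto)
  finally show ?thesis by simp
qed

lemma real_choose_two: "real (n choose 2) = real n * (real n - 1) / 2"
proof -
  have "2 * (n choose 2) = n * (n - 1)"
    unfolding choose_two by (rule dvd_mult_div_cancel) (cases "even n", auto)
  then have "real (2 * (n choose 2)) = real (n * (n - 1))" by (rule arg_cong)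
  then show ?thesis by (cases n) (auto simp: algebra_simps)
qed

text \<open>The two orders of each pair cancel the 2 in \<open>n choose 2 = n * (n - 1) / 2\<close>.
  For at most one vertex the denominators of the pair terms vanish, and division by zero yields 0 on
  both sides.\<close>

lemma lubell_singletons_pairs:
  assumes "hypergraph G" "finite (verts G)" "edge_types G \<subseteq> {1, 2}"
  shows "lubell G = card {v \<in> verts G. {v} \<in> edges G} / card (verts G) +
    card (arcs (\<lambda>u v. u \<noteq> v \<and> {u, v} \<in> edges G) (verts G)) /
      (real (card (verts G)) * (real (card (verts G)) - 1))"
proof -
  let ?n = "card (verts G)"
  \<comment> \<open>\<open>G\<close> may lack one of the edge types; an empty level contributes
    0.\<close>
  have "lubell G = (\<Sum>k\<in>{1, 2}. real (card (edges (level G k))) / real (?n choose k))"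
    unfolding lubell_def
  proof (rule sum.mono_neutral_left)
    show "\<forall>k\<in>{1, 2} - edge_types G. real (card (edges (level G k))) / real (?n choose k) = 0"
    proof
      fix k assume "k \<in> {1, 2} - edge_types G"
      then have "edges (level G k) = {}" by (auto simp: edge_types_def level_def)
      then show "real (card (edges (level G k))) / real (?n choose k) = 0" by simp
    qed
  qed (use assms in auto)
  also have "\<dots> = card (edges (level G 1)) / ?n + card (edges (level G 2)) / (?n choose 2)"
    by simp
  also have "edges (level G 1) = (\<lambda>v. {v}) ` {v \<in> verts G. {v} \<in> edges G}"
    using assms(1) by (auto simp: level_def hypergraph_def card_1_singleton_iff)
  also have "card \<dots> = card {v \<in> verts G. {v} \<in> edges G}"
    by (rule card_image) auto
  also have "edges (level G 2) = {e \<in> edges G. e \<subseteq> verts G \<and> card e = 2}"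
    using assms(1) by (auto simp: level_def hypergraph_def)
  also have "real (card \<dots>) / (?n choose 2) =
      card (arcs (\<lambda>u v. u \<noteq> v \<and> {u, v} \<in> edges G) (verts G)) / (real ?n * (real ?n - 1))"
    unfolding card_arcs_edges[OF assms(2)] real_choose_two by simp
  finally show ?thesis .
qed

section \<open>Finding \<open>H\<close> in a blow-up\<close>

text \<open>Every part has room for all vertices of \<open>H\<close>, so \<open>v\<close> can be
  sent into the part numbered by its colour. Pairs of \<open>H\<close> then join different parts,
  and its singletons land in \<open>S\<close>, where all singletons are edges of
  \<open>G\<close>.\<close>

lemma blowup_embeds:
  assumes H: "hypergraph H" "finite (verts H)" "edge_types H \<subseteq> {1, 2}"
    and col: "proper_coloring (level H 2) k c"
    and S: "finite S" "S \<subseteq> verts G" "\<And>v. v \<in> S \<Longrightarrow> {v} \<in> edges G"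
    and blowup: "has_blowup (\<lambda>u v. u \<noteq> v \<and> {u, v} \<in> edges G) S k (card (verts H))"
  shows "\<exists>F'. subhypergraph F' G \<and> isomorphic F' H"
proof -
  obtain B where "\<forall>i<k. B i \<subseteq> S \<and> card (B i) = card (verts H)"
    and "\<forall>i<k. \<forall>j<k. i \<noteq> j \<longrightarrow> (\<forall>u\<in>B i. \<forall>v\<in>B j. u \<noteq> v \<and> {u, v} \<in> edges G)"
    using blowup unfolding has_blowup_def by blast
  then have B: "\<And>i. i < k \<Longrightarrow> B i \<subseteq> S" "\<And>i. i < k \<Longrightarrow> card (B i) = card (verts H)"
    and adj: "\<And>i j u v. i < k \<Longrightarrow> j < k \<Longrightarrow> i \<noteq> j \<Longrightarrow> u \<in> B i \<Longrightarrow> v \<in> B j \<Longrightarrow>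
      u \<noteq> v \<and> {u, v} \<in> edges G"
    by simp_all
  have "\<exists>g. bij_betw g (verts H) (B i)" if "i < k" for i
    using B[OF that] H(2) S(1) by (intro finite_same_card_bij) (auto intro: finite_subset)
  then obtain g where g: "\<And>i. i < k \<Longrightarrow> bij_betw (g i) (verts H) (B i)"
    by metis
  define f where "f v = g (c v) v" for v
  have c: "c v < k" if "v \<in> verts H" for v
    using col that by (auto simp: proper_coloring_def level_def)
  have fB: "f v \<in> B (c v)" if "v \<in> verts H" for v
    using g[OF c[OF that]] that by (auto simp: f_def bij_betw_def)
  have inj: "inj_on f (verts H)"
  proof (rule inj_onI)
    fix u v assume uv: "u \<in> verts H" "v \<in> verts H" "f u = f v"
    \<comment> \<open>Different colours mean different parts, between which \<open>adj\<close>
      includes inequality; within one part \<open>g\<close> is injective.\<close>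
    have "c u = c v" using adj[OF c c _ fB fB] uv by blast
    then show "u = v"
      using uv bij_betw_imp_inj_on[OF g[OF c]] by (metis f_def inj_onD)
  qed
  define F where "F = (f ` verts H, (\<lambda>e. f ` e) ` edges H)"
  have "f ` e \<in> edges G" if e: "e \<in> edges H" for e
  proof -
    have sub: "e \<subseteq> verts H" using H(1) e by (auto simp: hypergraph_def)
    have "card e = 1 \<or> card e = 2" using H(3) e by (auto simp: edge_types_def)
    then show ?thesis
    proof
      assume "card e = 1"
      then obtain v where v: "e = {v}" by (auto simp: card_1_singleton_iff)
      then have "f v \<in> S" using fB B(1) c sub by auto
      then show ?thesis using S(3) v by auto
    next
      assume "card e = 2"
      moreover then obtain u v where uv: "e = {u, v}" "u \<noteq> v" by (auto simp: card_2_iff)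
      ultimately have "c u \<noteq> c v"
        using col e by (auto simp: proper_coloring_def level_def)
      then show ?thesis using adj[OF c c _ fB fB] uv sub by auto
    qed
  qed
  then have "subhypergraph F G"
    using H(1) fB B(1) c S(2) unfolding subhypergraph_def hypergraph_def F_def
    by (auto; blast)
  moreover have "isomorphic F H"
    unfolding isomorphic_def
  proof (intro exI conjI)
    \<comment> \<open>\<open>isomorphic\<close> asks for a map from the copy to \<open>H\<close>,
      hence the inverse of \<open>f\<close>.\<close>
    show "bij_betw (inv_into (verts H) f) (verts F) (verts H)"
      unfolding F_def using inj by (simp add: bij_betw_inv_into inj_on_imp_bij_betw)
    have "inv_into (verts H) f ` f ` e = e" if "e \<in> edges H" for e
      using inj H(1) that by (intro inv_into_image_cancel) (auto simp: hypergraph_def)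
    then show "(\<lambda>e. inv_into (verts H) f ` e) ` edges F = edges H"
      by (force simp: F_def image_image)
  qed
  ultimately show ?thesis by blast
qed

section \<open>Chromatic number and bipartiteness\<close>

text \<open>The \<open>LEAST\<close> is attained once some colouring exists; numbering the vertices
  injectively gives one.\<close>

lemma proper_coloring_chromatic_number:
  assumes "hypergraph G" "finite (verts G)"
  shows "\<exists>c. proper_coloring G (chromatic_number G) c"
proof -
  obtain h where h: "bij_betw h (verts G) {0..<card (verts G)}"
    using ex_bij_betw_finite_nat[OF assms(2)] by blast
  have "proper_coloring G (card (verts G)) h"
    unfolding proper_coloring_def
  proof (intro conjI allI impI)
    show "h ` verts G \<subseteq> {..<card (verts G)}"
      using bij_betw_imp_surj_on[OF h] by (simp add: atLeast0LessThan)
    fix u v assume "u \<noteq> v" "{u, v} \<in> edges G"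
    moreover from this have "u \<in> verts G" "v \<in> verts G"
      using assms(1) by (auto simp: hypergraph_def)
    ultimately show "h u \<noteq> h v"
      using inj_onD[OF bij_betw_imp_inj_on[OF h]] by blast
  qed
  then have "\<exists>k c. proper_coloring G k c" by blast
  then show ?thesis
    unfolding chromatic_number_def by (rule LeastI_ex)
qed

lemma chromatic_number_le: "proper_coloring G k c \<Longrightarrow> chromatic_number G \<le> k"
  unfolding chromatic_number_def by (rule Least_le) blast

text \<open>Used contrapositively, to get a chromatic number of at least 3 and so
  \<open>r \<ge> 2\<close>.\<close>

lemma two_colorable_bipartite:
  assumes "hypergraph G" "\<And>e. e \<in> edges G \<Longrightarrow> card e = 2" "proper_coloring G k c" "k \<le> 2"
  shows "bipartite G"
proof -
  have c: "c v = 0 \<or> c v = 1" if "v \<in> verts G" for v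
  proof -
    have "c v < k" using assms(3) that by (auto simp: proper_coloring_def)
    then show ?thesis using assms(4) by linarith
  qed
  have "\<exists>a\<in>{v \<in> verts G. c v = 0}. \<exists>b\<in>{v \<in> verts G. c v = 1}. e = {a, b}" if e: "e \<in> edges G" for e
  proof -
    obtain u v where uv: "e = {u, v}" "u \<noteq> v"
      using assms(2)[OF e] by (auto simp: card_2_iff)
    then have "u \<in> verts G" "v \<in> verts G" using assms(1) e by (auto simp: hypergraph_def)
    moreover have "c u \<noteq> c v" using assms(3) e uv by (auto simp: proper_coloring_def)
    ultimately show ?thesis using c[of u] c[of v] uv by auto
  qed
  then show ?thesis unfolding bipartite_def
    by (intro exI[of _ "{v \<in> verts G. c v = 0}"] exI[of _ "{v \<in> verts G. c v = 1}"]) (use c in auto)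
qed

section \<open>The lower bound construction\<close>

text \<open>Taking residue classes as parts makes them nearly equal and provides the colouring
  \<open>v mod r\<close> at once.\<close>

definition turan_graph :: "nat \<Rightarrow> nat \<Rightarrow> nat hypergraph" where
  "turan_graph n r = ({1..n}, {e. e \<subseteq> {1..n} \<and>
     (card e = 1 \<or> card e = 2 \<and> inj_on (\<lambda>v. v mod r) e)})"

text \<open>A copy of \<open>H\<close> pulls the residue colouring back to the level graph
  \<open>level H 2\<close>.\<close>

lemma turan_graph_free:
  assumes "r > 0" "subhypergraph F (turan_graph n r)" "isomorphic F H" "hypergraph H"
  shows "chromatic_number (level H 2) \<le> r"
proof -
  obtain f where f: "bij_betw f (verts F) (verts H)" "(\<lambda>e. f ` e) ` edges F = edges H"
    using assms(3) by (auto simp: isomorphic_def)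
  define g where "g = inv_into (verts F) f"
  have "g u mod r \<noteq> g v mod r" if uv: "u \<noteq> v" "{u, v} \<in> edges (level H 2)" for u v
  proof -
    have "{u, v} \<in> (\<lambda>e. f ` e) ` edges F" using uv(2) f(2) by (simp add: level_def)
    then obtain e where e: "e \<in> edges F" "{u, v} = f ` e" by blast
    have "e \<subseteq> verts F" using e assms(2) by (auto simp: subhypergraph_def hypergraph_def)
    then have "g ` f ` e = e"
      unfolding g_def by (rule inv_into_image_cancel[OF bij_betw_imp_inj_on[OF f(1)]])
    then have e_eq: "e = {g u, g v}" using e(2) by (metis image_empty image_insert)
    have uvH: "{u, v} \<subseteq> verts H" using uv assms(4) by (auto simp: level_def hypergraph_def)
    have "inj_on g (verts H)"
      unfolding g_def using f(1) by (metis bij_betw_def bij_betw_inv_into)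
    then have guv: "g u \<noteq> g v" using uvH uv(1) by (auto dest: inj_onD)
    have "e \<in> edges (turan_graph n r)" using e assms(2) by (auto simp: subhypergraph_def)
    then have "inj_on (\<lambda>v. v mod r) {g u, g v}"
      using guv by (auto simp: e_eq turan_graph_def)
    then show ?thesis using guv by auto
  qed
  then have "proper_coloring (level H 2) r (\<lambda>v. g v mod r)"
    using assms(1) by (auto simp: proper_coloring_def)
  then show ?thesis by (rule chromatic_number_le)
qed

text \<open>Within a class \<open>v\<close> is determined by \<open>v div r\<close>, which takes
  values from 0 to \<open>n div r\<close>.\<close>

lemma card_residue_class_le:
  assumes "r > 0"
  shows "card {v \<in> {1..n}. v mod r = i} \<le> n div r + 1"
proof -
  have "inj_on (\<lambda>v. v div r) {v \<in> {1..n}. v mod r = i}"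
    by (rule inj_onI) (clarsimp, metis div_mult_mod_eq)
  moreover have "(\<lambda>v. v div r) ` {v \<in> {1..n}. v mod r = i} \<subseteq> {..n div r}"
    by (auto simp: div_le_mono)
  ultimately have "card {v \<in> {1..n}. v mod r = i} \<le> card {..n div r}"
    by (intro card_inj_on_le) auto
  then show ?thesis by simp
qed

text \<open>Singletons contribute 1. For the pairs, the non-arcs are counted: they lie in
  \<open>?D\<close>, the ordered pairs with equal residues, diagonal included.\<close>

lemma lubell_turan_graph:
  assumes "r > 0" "n > 1"
  shows "1 + (real n ^ 2 - n * (n / r + 1)) / (real n * (real n - 1)) \<le> lubell (turan_graph n r)"
proof -
  let ?A = "arcs (\<lambda>u v. u \<noteq> v \<and> {u, v} \<in> edges (turan_graph n r)) {1..n}"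
  let ?D = "SIGMA u:{1..n}. {v \<in> {1..n}. v mod r = u mod r}"
  have "{1..n} \<times> {1..n} \<subseteq> ?A \<union> ?D"
    by (auto simp: arcs_def turan_graph_def card_2_iff inj_on_def)
  then have "card ({1..n} \<times> {1..n}) \<le> card (?A \<union> ?D)"
    by (rule card_mono[rotated]) (auto simp: finite_arcs)
  also have "\<dots> \<le> card ?A + card ?D" by (rule card_Un_le)
  also have "card ?D = (\<Sum>u\<in>{1..n}. card {v \<in> {1..n}. v mod r = u mod r})"
    by (rule card_SigmaI) auto
  also have "\<dots> \<le> (\<Sum>u\<in>{1..n}. n div r + 1)"
    by (intro sum_mono card_residue_class_le assms)
  finally have "n * n \<le> card ?A + n * (n div r + 1)"
    by (simp add: card_cartesian_product)
  then have "real (n * n) \<le> real (card ?A + n * (n div r + 1))"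
    by (simp only: of_nat_le_iff)
  also have "\<dots> = real (card ?A) + real n * (real (n div r) + 1)" by (simp add: algebra_simps)
  also have "\<dots> \<le> real (card ?A) + real n * (n / r + 1)"
    by (intro add_left_mono mult_left_mono add_right_mono of_nat_div_le_of_nat) auto
  finally have A: "real n ^ 2 - n * (n / r + 1) \<le> card ?A"
    by (simp add: power2_eq_square)
  have verts: "verts (turan_graph n r) = {1..n}" by (simp add: turan_graph_def)
  have "{v \<in> {1..n}. {v} \<in> edges (turan_graph n r)} = {1..n}"
    by (auto simp: turan_graph_def)
  then have singles: "card {v \<in> {1..n}. {v} \<in> edges (turan_graph n r)} = n" by simp
  have "hypergraph (turan_graph n r)" "edge_types (turan_graph n r) \<subseteq> {1, 2}"
    by (auto simp: hypergraph_def edge_types_def turan_graph_def)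
  then have "lubell (turan_graph n r) = 1 + card ?A / (real n * (real n - 1))"
    using lubell_singletons_pairs[of "turan_graph n r"] assms verts singles by simp
  also have "\<dots> \<ge> 1 + (real n ^ 2 - n * (n / r + 1)) / (real n * (real n - 1))"
    using A assms by (intro add_left_mono divide_right_mono) auto
  finally show ?thesis .
qed

section \<open>The \<open>H\<close>-free hypergraphs over which the maximum is taken\<close>

definition extremal_candidates :: "'a hypergraph \<Rightarrow> nat \<Rightarrow> nat hypergraph set" where
  "extremal_candidates F n = {G. card (verts G) = n \<and>
     subhypergraph G (complete_hypergraph (edge_types F) n) \<and>
     \<not> (\<exists>F'. subhypergraph F' G \<and> isomorphic F' F)}"

lemma max_lubell_eq: "max_lubell F n = Max (lubell ` extremal_candidates F n)"
  by (simp only: max_lubell_def extremal_candidates_def setcompr_eq_image)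

lemma finite_extremal_candidates: "finite (extremal_candidates F n)"
proof (rule finite_subset)
  show "extremal_candidates F n \<subseteq> Pow {1..n} \<times> Pow (Pow {1..n})"
    by (auto simp: extremal_candidates_def subhypergraph_def complete_hypergraph_def hypergraph_def)
qed auto

lemma turan_graph_candidate:
  assumes "r > 0" "hypergraph H" "edge_types H = {1, 2}" "r < chromatic_number (level H 2)"
  shows "turan_graph n r \<in> extremal_candidates H n"
proof -
  have "\<not> (\<exists>F'. subhypergraph F' (turan_graph n r) \<and> isomorphic F' H)"
    using turan_graph_free[OF assms(1) _ _ assms(2)] assms(4) by (meson not_le)
  moreover have "subhypergraph (turan_graph n r) (complete_hypergraph {1, 2} n)"
    "card (verts (turan_graph n r)) = n"
    by (auto simp: subhypergraph_def complete_hypergraph_def hypergraph_def turan_graph_def)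
  ultimately show ?thesis
    unfolding extremal_candidates_def assms(3) by blast
qed

section \<open>The upper bound\<close>

text \<open>The difference of the two sides factors with a zero at \<open>x = 1\<close>, and
  \<open>r \<ge> 2\<close> makes the other factor nonnegative. For \<open>r = 1\<close> the left
  side would be largest at \<open>x = 1 / 2\<close>.\<close>

lemma quadratic_le_at_one:
  fixes x :: real
  assumes "0 \<le> x" "x \<le> 1" "2 \<le> r"
  shows "x - x\<^sup>2 / r \<le> 1 - 1 / r"
proof -
  have "0 \<le> (1 - x) * (r - (1 + x)) / r" using assms by simp
  also have "\<dots> = (1 - 1 / r) - (x - x\<^sup>2 / r)"
    using assms by (simp add: field_simps power2_eq_square)
  finally show ?thesis by simp
qed

text \<open>Erdos-Stone is applied only inside \<open>S\<close>, where a blow-up also carries the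
  singletons of \<open>H\<close>. One \<open>\<eta>\<close> pays for its error, the other for the
  lower order terms.\<close>

lemma lubell_candidate_le:
  fixes H :: "'a hypergraph" and \<eta> :: real
  assumes H: "hypergraph H" "finite (verts H)" "edge_types H = {1, 2}"
    and chi: "chromatic_number (level H 2) = Suc r" and r: "r \<ge> 2" and \<eta>: "\<eta> > 0"
  shows "\<exists>N. \<forall>n\<ge>N. \<forall>G\<in>extremal_candidates H n. lubell G \<le> 2 - 1 / r + 2 * \<eta>"
proof -
  have "hypergraph (level H 2)" "finite (verts (level H 2))"
    using H by (auto simp: level_def hypergraph_def)
  then obtain c where c: "proper_coloring (level H 2) (Suc r) c"
    using proper_coloring_chromatic_number chi by metis
  obtain s0 where s0: "\<forall>(V :: nat set) adj. finite V \<longrightarrow> symp adj \<longrightarrow> irreflp adj \<longrightarrow> s0 \<le> card V \<longrightarrow>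
    (1 - 1 / r + \<eta>) * (card V)\<^sup>2 \<le> card (arcs adj V) \<longrightarrow> has_blowup adj V (Suc r) (card (verts H))"
    using erdos_stone[of r \<eta>] r \<eta> by (metis gr0I not_numeral_le_zero)
  \<comment> \<open>The first summand bounds \<open>x\<close> when \<open>S\<close> is too small for
    Erdos-Stone; the second covers the change from \<open>n * (n - 1)\<close> to
    \<open>n\<^sup>2\<close> in the pair density.\<close>
  have "eventually (\<lambda>n. real s0 / n + (1 + \<eta>) / (real n - 1) \<le> \<eta>) sequentially"
    using \<eta> by real_asymp
  then have "eventually (\<lambda>n. real s0 / n + (1 + \<eta>) / (real n - 1) \<le> \<eta> \<and> n > 1) sequentially"
    using eventually_gt_at_top[of 1] by (rule eventually_conj)
  then obtain N where N: "\<And>n. n \<ge> N \<Longrightarrow> real s0 / n + (1 + \<eta>) / (real n - 1) \<le> \<eta> \<and> n > 1"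
    by (auto simp: eventually_sequentially)
  have "lubell G \<le> 2 - 1 / r + 2 * \<eta>" if n: "n \<ge> N" and G: "G \<in> extremal_candidates H n" for n G
  proof -
    define adj where "adj u v \<longleftrightarrow> u \<noteq> v \<and> {u, v} \<in> edges G" for u v
    have adj_eq: "adj = (\<lambda>u v. u \<noteq> v \<and> {u, v} \<in> edges G)" by (simp add: adj_def fun_eq_iff)
    have adj: "symp adj" "irreflp adj"
      by (auto simp: adj_def symp_def irreflp_def insert_commute)
    define S where "S = {v \<in> verts G. {v} \<in> edges G}"
    have hG: "hypergraph G" "verts G \<subseteq> {1..n}" "card (verts G) = n" "edge_types G \<subseteq> {1, 2}"
      using G unfolding extremal_candidates_def subhypergraph_def complete_hypergraph_def H(3)
      by (auto simp: edge_types_def)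
    have fin: "finite (verts G)" using hG(2) by (rule finite_subset) simp
    have S: "S \<subseteq> verts G" "finite S" using fin by (auto simp: S_def)
    have n1: "n > 1" "real s0 / n + (1 + \<eta>) / (real n - 1) \<le> \<eta>" using N[OF n] by auto
    define x where "x = card S / n"
    have "card S \<le> n" using S fin hG(3) card_mono by metis
    then have x: "0 \<le> x" "x \<le> 1" "real (card S) = x * n" using n1 by (auto simp: x_def)
    define q where "q = card (arcs adj (verts G)) / (real n)\<^sup>2"
    have lub: "lubell G = x + q * n / (real n - 1)"
      using lubell_singletons_pairs[OF hG(1) fin hG(4)] n1
      by (simp add: hG(3) S_def x_def adj_eq q_def power2_eq_square)
    have split: "q * n / (real n - 1) = q + q / (real n - 1)"
      using n1 by (simp add: field_simps)
    have q_le: "q \<le> 1"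
      using card_arcs_le[OF fin, of adj] n1 hG(3)
      by (simp add: q_def power2_eq_square flip: of_nat_mult)
    have "q / (real n - 1) \<le> (1 + \<eta>) / (real n - 1)"
      using q_le \<eta> n1 by (intro divide_right_mono) auto
    then have lub2: "lubell G \<le> x + q + (1 + \<eta>) / (real n - 1)"
      using lub split by simp
    show ?thesis
    \<comment> \<open>For small \<open>S\<close> the singletons are negligible, and the trivial
      bound \<open>q \<le> 1\<close> suffices since \<open>1 \<le> 2 - 1 / r\<close>.\<close>
    proof (cases "card S < s0")
      case True
      then have "x \<le> s0 / n" by (simp add: x_def divide_right_mono)
      moreover have "1 / real r \<le> 1" using r by simp
      ultimately show ?thesis using lub2 q_le n1 \<eta> by linarith
    next
      case False
      have "\<not> has_blowup adj S (Suc r) (card (verts H))"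
      proof
        assume "has_blowup adj S (Suc r) (card (verts H))"
        then have "\<exists>F'. subhypergraph F' G \<and> isomorphic F' H"
          unfolding adj_eq
          by (intro blowup_embeds[OF H(1,2) _ c S(2,1)]) (use H(3) in \<open>simp_all add: S_def\<close>)
        then show False using G by (auto simp: extremal_candidates_def)
      qed
      then have sparse: "card (arcs adj S) < (1 - 1 / r + \<eta>) * (card S)\<^sup>2"
        using s0 S(2) adj False by (meson not_le)
      \<comment> \<open>All pairs not inside \<open>S\<close> are conceded as arcs.\<close>
      have "arcs adj (verts G) \<subseteq> arcs adj S \<union> (verts G \<times> verts G - S \<times> S)"
        by (auto simp: arcs_def)
      then have "card (arcs adj (verts G)) \<le> card (arcs adj S \<union> (verts G \<times> verts G - S \<times> S))"
        by (rule card_mono[rotated]) (use fin S in \<open>auto simp: finite_arcs\<close>)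
      also have "\<dots> \<le> card (arcs adj S) + card (verts G \<times> verts G - S \<times> S)"
        by (rule card_Un_le)
      also have "card (verts G \<times> verts G - S \<times> S) = n * n - card S * card S"
        using S hG(3) by (subst card_Diff_subset) (auto simp: card_cartesian_product)
      finally have "card (arcs adj (verts G)) + card S * card S \<le> card (arcs adj S) + n * n"
        using \<open>card S \<le> n\<close> mult_le_mono[of "card S" n "card S" n] by linarith
      then have "real (card (arcs adj (verts G)) + card S * card S) \<le> real (card (arcs adj S) + n * n)"
        by (simp only: of_nat_le_iff)
      then have "real (card (arcs adj (verts G))) \<le> (real n)\<^sup>2 - (1 / r - \<eta>) * (real (card S))\<^sup>2"
        using sparse by (simp add: algebra_simps power2_eq_square)
      also have "\<dots> = (1 - (1 / r - \<eta>) * x\<^sup>2) * (real n)\<^sup>2"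
        unfolding x(3) by (simp add: algebra_simps power2_eq_square)
      finally have "q \<le> 1 - (1 / r - \<eta>) * x\<^sup>2"
        using n1 by (simp add: q_def divide_le_eq)
      also have "\<dots> = 1 - x\<^sup>2 / r + \<eta> * x\<^sup>2" by (simp add: algebra_simps)
      finally have "q \<le> 1 - x\<^sup>2 / r + \<eta> * x\<^sup>2" .
      moreover have "\<eta> * x\<^sup>2 \<le> \<eta> * 1"
        using x \<eta> by (intro mult_left_mono) (auto simp: power_le_one)
      moreover have "x - x\<^sup>2 / r \<le> 1 - 1 / r" using quadratic_le_at_one x r by simp
      moreover have "(1 + \<eta>) / (real n - 1) \<le> \<eta>"
        using n1(2) by (smt (verit) divide_nonneg_nonneg of_nat_0_le_iff)
      ultimately show ?thesis using lub2 by linarith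
    qed
  qed
  then show ?thesis by blast
qed

section \<open>Convergence and the value of the limit\<close>

theorem theorem1p3:
  fixes H :: "'a hypergraph"
  assumes "hypergraph H"
    and "finite (verts H)"
    and "edge_types H = {1, 2}"
    and "\<not> bipartite (level H 2)"
  shows "convergent (max_lubell H) \<and>
    turan_density H = 2 - 1 / (real (chromatic_number (level H 2)) - 1)"
proof -
  define r where "r = chromatic_number (level H 2) - 1"
  have hyp: "hypergraph (level H 2)" and fin: "finite (verts (level H 2))"
    using assms(1,2) by (auto simp: hypergraph_def level_def)
  have "\<not> chromatic_number (level H 2) \<le> 2"
    using two_colorable_bipartite[OF hyp] proper_coloring_chromatic_number[OF hyp fin] assms(4)
    by (auto simp: level_def)
  then have r: "r \<ge> 2" and chi: "chromatic_number (level H 2) = Suc r"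
    by (auto simp: r_def)
  have cand: "turan_graph n r \<in> extremal_candidates H n" for n
    by (rule turan_graph_candidate) (use assms r chi in auto)
  have "max_lubell H \<longlonglongrightarrow> 2 - 1 / r"
  proof (rule order_tendstoI)
    fix a assume "a < 2 - 1 / real r"
    moreover have "(\<lambda>n. 1 + (real n ^ 2 - n * (n / r + 1)) / (real n * (real n - 1))) \<longlonglongrightarrow> 2 - 1 / r"
      using r by (real_asymp simp: inverse_eq_divide)
    ultimately have "eventually (\<lambda>n. a < 1 + (real n ^ 2 - n * (n / r + 1)) / (real n * (real n - 1))) sequentially"
      by (intro order_tendstoD)
    then show "eventually (\<lambda>n. a < max_lubell H n) sequentially"
      using eventually_gt_at_top[of 1]
    proof eventually_elim
      case (elim n)
      have "lubell (turan_graph n r) \<le> max_lubell H n"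
        unfolding max_lubell_eq by (rule Max_ge) (use cand finite_extremal_candidates[of H n] in auto)
      with elim lubell_turan_graph[of r n] r show ?case by simp
    qed
  next
    fix b assume b: "2 - 1 / real r < b"
    \<comment> \<open>A quarter of the gap, so that the error \<open>2 * \<eta>\<close> stays
      strictly below it.\<close>
    define \<eta> where "\<eta> = (b - (2 - 1 / r)) / 4"
    have \<eta>: "\<eta> > 0" using b by (simp add: \<eta>_def)
    obtain N where N: "\<forall>n\<ge>N. \<forall>G\<in>extremal_candidates H n. lubell G \<le> 2 - 1 / r + 2 * \<eta>"
      using lubell_candidate_le[OF assms(1-3) chi r \<eta>] by (rule exE)
    have "max_lubell H n < b" if "n \<ge> N" for n
    proof -
      have "max_lubell H n \<le> 2 - 1 / r + 2 * \<eta>"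
        unfolding max_lubell_eq
        \<comment> \<open>\<open>cand\<close> also supplies the nonemptiness that
          \<open>Max_le_iff\<close> requires.\<close>
        by (subst Max_le_iff) (use cand[of n] finite_extremal_candidates[of H n] N that in auto)
      also have "\<dots> < b" using b by (simp add: \<eta>_def field_simps)
      finally show ?thesis .
    qed
    then show "eventually (\<lambda>n. max_lubell H n < b) sequentially"
      by (auto simp: eventually_sequentially)
  qed
  then have "convergent (max_lubell H)" "turan_density H = 2 - 1 / r"
    unfolding turan_density_def by (rule convergentI, rule limI)
  then show ?thesis by (simp add: chi)
qed

end
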